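(* The following hold: (1) $F_2(N)=2N-3$ for every integer $N>2$; (2) $F_3(N)\ge N^2/2-O(N)$, i.e. there is an absolute constant $C$ such that $F_3(N)\ge N^2/2-CN$ for all integers $N>3$; (3) for every integer $k\ge 4$, $F_k(N)=\Omega_k(N^{k-1})$, i.e. there are a constant $c_k>0$ and an integer $N_k$, depending only on $k$, such that $F_k(N)\ge c_kN^{k-1}$ for all $N\ge N_k$.
   Context: For a positive integer $N$ let $[N]=\{1,2,\dots,N\}$, and let $\binom{[N]}{k}$ denote the family of all $k$-element subsets of $[N]$. For sets of integers $A,B$, the sumset is $A+B=\{a+b: a\in A, b\in B\}$. A family $\mathcal A=\{A_i: i\in I\}$ of (distinct) subsets of $\mathbb Z$ is a Sidon system if $A_i+A_j=A_{i'}+A_{j'}$ implies $\{i,j\}=\{i',j'\}$ for all $i,j,i',j'\in I$. For integers $N>k\ge 1$, $F_k(N)$ denotes the largest cardinality of a Sidon system $\mathcal A\subseteq\binom{[N]}{k}$. *)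

theory Defs
  imports Complex_Main "HOL-Library.Set_Algebras" "HOL-Library.Ramsey"
begin

text \<open>
  The sumset of two sets is their sum in the sense of \<^theory>\<open>HOL-Library.Set_Algebras\<close>.
  A family of distinct sets is modelled as a set of sets, so that the sets themselves
  serve as indices. Repetitions \<open>A = B\<close> are not excluded.
\<close>

definition sidon_system :: "int set set \<Rightarrow> bool" where
  "sidon_system \<A> \<longleftrightarrow>
     (\<forall>A\<in>\<A>. \<forall>B\<in>\<A>. \<forall>C\<in>\<A>. \<forall>D\<in>\<A>. A + B = C + D \<longrightarrow> {A, B} = {C, D})"

definition sidon_F :: "nat \<Rightarrow> nat \<Rightarrow> nat" where
  "sidon_F k N = Max (card ` {\<A>. \<A> \<subseteq> nsets {1..int N} k \<and> sidon_system \<A>})"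

text \<open>The maximum ranges over a finite nonempty set, so it is attained.\<close>

lemma finite_sidon_systems: "finite {\<A>. \<A> \<subseteq> nsets {1..int N} k \<and> sidon_system \<A>}"
proof (rule finite_subset)
  show "{\<A>. \<A> \<subseteq> nsets {1..int N} k \<and> sidon_system \<A>} \<subseteq> Pow (Pow {1..int N})"
    by (auto simp: nsets_def)
qed simp

lemma sidon_F_attained:
  "\<exists>\<A>. \<A> \<subseteq> nsets {1..int N} k \<and> sidon_system \<A> \<and> card \<A> = sidon_F k N"
proof -
  let ?S = "{\<A>. \<A> \<subseteq> nsets {1..int N} k \<and> sidon_system \<A>}"
  have "{} \<in> ?S" by (simp add: sidon_system_def)
  hence "sidon_F k N \<in> card ` ?S"
    unfolding sidon_F_def by (intro Max_in finite_imageI finite_sidon_systems) auto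
  thus ?thesis by auto
qed

lemma card_le_sidon_F:
  assumes "\<A> \<subseteq> nsets {1..int N} k" "sidon_system \<A>"
  shows "card \<A> \<le> sidon_F k N"
  unfolding sidon_F_def using assms by (intro Max_ge finite_imageI finite_sidon_systems imageI CollectI conjI)

end

theory Submission
  imports Defs
begin

text \<open>
  Sidon systems are invariant under translation, so subsets of \<open>{0..<N}\<close> may be used.

  \<^item> For \<open>k = 2\<close> write the sets as \<open>{a, a + d}\<close> and let \<open>A\<^sub>d\<close> be the set of the \<open>a\<close> that occur
    with gap \<open>d\<close>. The Sidon property makes all positive differences inside the sets \<open>A\<^sub>d\<close>
    distinct, across all \<open>d\<close>. There are at most \<open>N - 1\<close> minima of the \<open>A\<^sub>d\<close>, and the
    differences to these minima are distinct elements of \<open>{1..N - 2}\<close>. The sets that contain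
    one of the endpoints attain the bound.
  \<^item> For \<open>k = 3\<close> the sets \<open>{0, a, b}\<close> with \<open>a < b\<close>, \<open>b \<noteq> 2 a\<close> and \<open>b \<noteq> 3 a\<close> form a Sidon system:
    the least positive and the greatest element of \<open>{0, a, b} + {0, c, d}\<close> are \<open>min a c\<close> and \<open>b + d\<close>,
    and locating a few further elements of one sumset in the other leaves no second solution.
  \<^item> For general \<open>k\<close> take the sets \<open>{2 L \<cdot> 2\<^sup>i + f i | i < k}\<close> with \<open>0 \<le> f i < L\<close> and \<open>f 0 = 0\<close>. The sums
    \<open>2\<^sup>i + 2\<^sup>j\<close> determine \<open>{i, j}\<close>, so the sumset of the sets of \<open>f\<close> and \<open>g\<close> determines every
    \<open>{f i + g j, f j + g i}\<close>, and these pairs determine \<open>{f, g}\<close>.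
\<close>

section \<open>Indexed families and translation\<close>

text \<open>Shifting every set by 1 shifts every sumset by 2, so equalities of sumsets survive the
  move to \<open>{1..int N}\<close>. Injectivity of the family is the Sidon hypothesis for repeated
  indices.\<close>

lemma card_le_sidon_F_family:
  fixes \<phi> :: "'i \<Rightarrow> int set"
  assumes nsets: "\<And>i. i \<in> I \<Longrightarrow> \<phi> i \<in> nsets {0..<int N} k"
    and sidon: "\<And>i j i' j'. \<lbrakk>i \<in> I; j \<in> I; i' \<in> I; j' \<in> I; \<phi> i + \<phi> j = \<phi> i' + \<phi> j'\<rbrakk>
      \<Longrightarrow> {i, j} = {i', j'}"
  shows "card I \<le> sidon_F k N"
proof -
  define \<psi> where "\<psi> i = (+) 1 ` \<phi> i" for i
  have \<psi>_sum: "\<psi> i + \<psi> j = (+) 2 ` (\<phi> i + \<phi> j)" for i j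
    unfolding \<psi>_def set_plus_image by (force simp: image_iff)
  have \<psi>_sidon: "{i, j} = {i', j'}"
    if "i \<in> I" "j \<in> I" "i' \<in> I" "j' \<in> I" "\<psi> i + \<psi> j = \<psi> i' + \<psi> j'" for i j i' j'
  proof (rule sidon)
    show "\<phi> i + \<phi> j = \<phi> i' + \<phi> j'"
      using that(5) by (simp add: \<psi>_sum inj_image_eq_iff)
  qed (use that in simp_all)
  have "inj_on \<psi> I"
  proof (rule inj_onI)
    fix i j assume "i \<in> I" "j \<in> I" "\<psi> i = \<psi> j"
    then have "{i, i} = {j, j}" by (intro \<psi>_sidon) simp_all
    then show "i = j" by simp
  qed
  then have "card I = card (\<psi> ` I)" by (simp add: card_image)
  also have "\<dots> \<le> sidon_F k N"
  proof (rule card_le_sidon_F)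
    show "\<psi> ` I \<subseteq> nsets {1..int N} k"
    proof
      fix A assume "A \<in> \<psi> ` I"
      then obtain i where "i \<in> I" "A = (+) 1 ` \<phi> i" by (auto simp: \<psi>_def)
      with nsets[of i] show "A \<in> nsets {1..int N} k"
        by (auto simp: nsets_def card_image)
    qed
    show "sidon_system (\<psi> ` I)"
      unfolding sidon_system_def
    proof (intro ballI impI)
      fix A B C D assume "A \<in> \<psi> ` I" "B \<in> \<psi> ` I" "C \<in> \<psi> ` I" "D \<in> \<psi> ` I" "A + B = C + D"
      then obtain i j i' j' where "i \<in> I" "j \<in> I" "i' \<in> I" "j' \<in> I"
        and eq: "A = \<psi> i" "B = \<psi> j" "C = \<psi> i'" "D = \<psi> j'" by blast
      with \<open>A + B = C + D\<close> have "{i, j} = {i', j'}" by (intro \<psi>_sidon) simp_all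
      then have "\<psi> ` {i, j} = \<psi> ` {i', j'}" by simp
      then show "{A, B} = {C, D}" by (simp add: eq)
    qed
  qed
  finally show ?thesis .
qed

section \<open>Two-element sets\<close>

text \<open>Above its least element \<open>a + b\<close> the sumset has the offsets 0,
  \<open>d\<close>, \<open>e\<close> and \<open>d + e\<close>. The greatest offset gives the sum of
  the gaps, the middle ones give the gaps.\<close>

lemma pair_sumset_eqD:
  fixes a b c d :: int
  assumes "0 < d" "0 < e" "0 < d'" "0 < e'"
    and eq: "{a, a + d} + {b, b + e} = {a', a' + d'} + {b', b' + e'}"
  shows "a + b = a' + b' \<and> (d = d' \<and> e = e' \<or> d = e' \<and> e = d')"
proof -
  have expand: "{x, x + u} + {y, y + v} = {x + y, x + y + u, x + y + v, x + y + u + v}" for x y u v :: int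
    by (auto simp: set_plus_def)
  define s t where "s = a + b" and "t = a' + b'"
  have st: "{s, s + d, s + e, s + d + e} = {t, t + d', t + e', t + d' + e'}"
    using eq unfolding expand s_def t_def .
  then have L: "\<And>x. x \<in> {s, s + d, s + e, s + d + e} \<Longrightarrow> x = t \<or> x = t + d' \<or> x = t + e' \<or> x = t + d' + e'"
    and R: "\<And>x. x \<in> {t, t + d', t + e', t + d' + e'} \<Longrightarrow> x = s \<or> x = s + d \<or> x = s + e \<or> x = s + d + e"
    by blast+
  have "s = t" using L[of s] R[of t] assms(1-4) by (smt insertCI)
  moreover have "d + e = d' + e'"
    using L[of "s + d + e"] R[of "t + d' + e'"] assms(1-4) \<open>s = t\<close> by (smt insertCI)
  ultimately show ?thesis
    using L[of "s + d"] L[of "s + e"] R[of "t + d'"] R[of "t + e'"] assms(1-4)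
    unfolding s_def t_def by (smt insertCI)
qed

lemma sidon_F_2_ge:
  assumes "N > 2"
  shows "2 * int N - 3 \<le> int (sidon_F 2 N)"
proof -
  define n where "n = int N - 1"
  define I where "I = {(a, d). 0 < d \<and> d \<le> n \<and> (a = 0 \<or> a = n - d)}"
  \<comment> \<open>For \<open>d = n\<close> both choices of \<open>a\<close> give
    \<open>(0, n)\<close>, so the second image stops at \<open>n - 1\<close>.\<close>
  have I_eq: "I = (\<lambda>d. (0, d)) ` {1..n} \<union> (\<lambda>d. (n - d, d)) ` {1..n - 1}"
    unfolding I_def using assms by (force simp: n_def)
  have "card I = card ((\<lambda>d. (0::int, d)) ` {1..n}) + card ((\<lambda>d. (n - d, d)) ` {1..n - 1})"
    unfolding I_eq by (rule card_Un_disjoint) auto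
  also have "\<dots> = nat n + nat (n - 1)"
    by (subst (1 2) card_image) (auto simp: inj_on_def)
  finally have card_I: "int (card I) = 2 * int N - 3"
    using assms by (simp add: n_def)
  have "card I \<le> sidon_F 2 N"
  proof (rule card_le_sidon_F_family[where \<phi> = "\<lambda>(a, d). {a, a + d}"])
    show "(case i of (a, d) \<Rightarrow> {a, a + d}) \<in> nsets {0..<int N} 2" if "i \<in> I" for i
      using that by (auto simp: I_def n_def nsets_def)
  next
    fix i j i' j'
    assume mem: "i \<in> I" "j \<in> I" "i' \<in> I" "j' \<in> I"
      and eq: "(case i of (a, d) \<Rightarrow> {a, a + d}) + (case j of (a, d) \<Rightarrow> {a, a + d}) =
        (case i' of (a, d) \<Rightarrow> {a, a + d}) + (case j' of (a, d) \<Rightarrow> {a, a + d})"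
    obtain a d b e a' d' b' e' where ij: "i = (a, d)" "j = (b, e)" "i' = (a', d')" "j' = (b', e')"
      by (metis surj_pair)
    have D: "a + b = a' + b' \<and> (d = d' \<and> e = e' \<or> d = e' \<and> e = d')"
      by (rule pair_sumset_eqD) (use mem eq in \<open>auto simp: ij I_def\<close>)
    then show "{i, j} = {i', j'}"
      using mem unfolding ij I_def by (auto simp: doubleton_eq_iff)
  qed
  with card_I show ?thesis by simp
qed

lemma sidon_F_2_le:
  assumes "N > 2"
  shows "int (sidon_F 2 N) \<le> 2 * int N - 3"
proof -
  obtain \<A> where sub: "\<A> \<subseteq> nsets {1..int N} 2" and sid: "sidon_system \<A>" and card: "card \<A> = sidon_F 2 N"
    using sidon_F_attained by blast
  define S where "S = {(d, a). 0 < d \<and> {a, a + d} \<in> \<A>}"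
  define m where "m d = Min {a. (d, a) \<in> S}" for d
  have S_bounds: "1 \<le> a \<and> 0 < d \<and> a + d \<le> int N" if "(d, a) \<in> S" for d a
    using that sub by (auto simp: S_def nsets_def)
  have fin: "finite {a. (d, a) \<in> S}" for d
    by (rule finite_subset[of _ "{1..int N}"]) (use S_bounds in force)+
  have m_mem: "(d, m d) \<in> S" if "(d, a) \<in> S" for d a
    using Min_in[OF fin[of d]] that unfolding m_def by blast
  have m_le: "m d \<le> a" if "(d, a) \<in> S" for d a
    using that fin unfolding m_def by simp
  let ?T = "{(d, a). (d, a) \<in> S \<and> a \<noteq> m d}"
  have finS: "finite S"
    by (rule finite_subset[of _ "{1..int N} \<times> {1..int N}"]) (use S_bounds in force)+
  have "\<A> \<subseteq> (\<lambda>(d, a). {a, a + d}) ` S"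
  proof
    fix A assume "A \<in> \<A>"
    with sub obtain x y where A: "A = {x, y}" "x \<noteq> y" by (auto simp: nsets_def card_2_iff)
    then have "A = {min x y, min x y + \<bar>x - y\<bar>}" by auto
    with \<open>A \<in> \<A>\<close> A(2) have "(\<bar>x - y\<bar>, min x y) \<in> S" by (simp add: S_def)
    then show "A \<in> (\<lambda>(d, a). {a, a + d}) ` S"
      using \<open>A = {min x y, _}\<close> by (intro image_eqI[where x = "(\<bar>x - y\<bar>, min x y)"]) simp_all
  qed
  then have "card \<A> \<le> card S"
    using finS by (meson card_image_le card_mono finite_imageI le_trans)
  \<comment> \<open>Each of the at most \<open>N - 1\<close> gaps has one pair with
    \<open>a = m d\<close>; \<open>?T\<close> collects the others.\<close>
  also have "S = {(d, a). (d, a) \<in> S \<and> a = m d} \<union> ?T" by auto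
  also have "card \<dots> \<le> card {(d, a). (d, a) \<in> S \<and> a = m d} + card ?T" by (rule card_Un_le)
  also have "card {(d, a). (d, a) \<in> S \<and> a = m d} \<le> card {1..int N - 1}"
    by (rule card_inj_on_le[where f = fst]) (use S_bounds in \<open>force simp: inj_on_def\<close>)+
  also have "card ?T \<le> card {1..int N - 2}"
  proof (rule card_inj_on_le[where f = "\<lambda>(d, a). a - m d"])
    show "(\<lambda>(d, a). a - m d) ` ?T \<subseteq> {1..int N - 2}"
    proof clarify
      fix d a assume "(d, a) \<in> S" "a \<noteq> m d"
      \<comment> \<open>Both \<open>d\<close> and \<open>m d\<close> are at least 1, which lowers
        the bound from \<open>N\<close> to \<open>N - 2\<close>.\<close>
      then show "a - m d \<in> {1..int N - 2}"
        using m_le[of d a] S_bounds[of d a] S_bounds[OF m_mem[of d a]] by simp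
    qed
    \<comment> \<open>Equal differences \<open>a - m d = a' - m d'\<close> give two decompositions of one sumset.\<close>
    show "inj_on (\<lambda>(d, a). a - m d) ?T"
    proof (rule inj_onI, clarify)
      fix d a d' a'
      assume S: "(d, a) \<in> S" "(d', a') \<in> S" and ne: "a \<noteq> m d" "a' \<noteq> m d'"
        and gap: "a - m d = a' - m d'"
      have sums: "{m d, m d + d} + {a', a' + d'} = {a, a + d} + {m d', m d' + d'}"
      proof -
        have "m d = a - (a' - m d')" using gap by simp
        then show ?thesis by (auto simp: set_plus_def)
      qed
      have mem: "{m d, m d + d} \<in> \<A>" "{a', a' + d'} \<in> \<A>" "{a, a + d} \<in> \<A>" "{m d', m d' + d'} \<in> \<A>"
        using S m_mem[OF S(1)] m_mem[OF S(2)] by (simp_all add: S_def)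
      have "{{m d, m d + d}, {a', a' + d'}} = {{a, a + d}, {m d', m d' + d'}}"
        by (rule sid[unfolded sidon_system_def, rule_format, OF mem sums])
      \<comment> \<open>This rules out one of the two matchings; the other identifies the gaps
        \<open>d\<close> and \<open>d'\<close>.\<close>
      moreover have "{m d, m d + d} \<noteq> {a, a + d}"
        using ne(1) S_bounds[OF S(1)] by (auto simp: doubleton_eq_iff)
      ultimately have "{m d, m d + d} = {m d', m d' + d'}"
        by (metis doubleton_eq_iff)
      then have "m d = m d'" "d = d'"
        using S_bounds[OF S(1)] S_bounds[OF S(2)] by (auto simp: doubleton_eq_iff)
      with gap show "d = d' \<and> a = a'" by simp
    qed
  qed simp
  finally show ?thesis using card assms by simp
qed

section \<open>Dyadic sets for general k\<close>

text \<open>For \<open>u \<le> v\<close> the sum \<open>2 ^ u + 2 ^ v\<close> is at most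
  \<open>2 ^ Suc v\<close>, hence less than any sum with a greater maximal exponent. Equal maxima
  force equal minima.\<close>

lemma sum_power2_eqD:
  fixes i j k l :: nat
  assumes "(2::int) ^ i + 2 ^ j = 2 ^ k + 2 ^ l"
  shows "{i, j} = {k, l}"
proof -
  have *: "j = l \<and> i = k" if "i \<le> j" "k \<le> l" "(2::int) ^ i + 2 ^ j = 2 ^ k + 2 ^ l" for i j k l :: nat
  proof -
    have "\<not> v < w" if "u \<le> v" "(2::int) ^ u + 2 ^ v = 2 ^ t + 2 ^ w" for u v t w :: nat
    proof
      assume "v < w"
      then have "(2::int) ^ Suc v \<le> 2 ^ w" by (intro power_increasing) auto
      moreover have "(2::int) ^ u \<le> 2 ^ v" using \<open>u \<le> v\<close> by simp
      moreover have "(0::int) < 2 ^ t" by simp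
      ultimately show False using that(2) by simp
    qed
    from this[of i j k l] this[of k l i j] that have "j = l" by simp
    with that(3) show ?thesis by simp
  qed
  have "(2::int) ^ min i j + 2 ^ max i j = 2 ^ min k l + 2 ^ max k l"
    using assms by (simp add: min_def max_def add.commute)
  then have "max i j = max k l \<and> min i j = min k l" by (intro *) simp_all
  then show ?thesis by (auto simp: min_def max_def split: if_splits)
qed

text \<open>The digits \<open>f i\<close> will lie below \<open>L\<close>; blocks of length
  \<open>2 * L\<close> then keep a sum of two digits from carrying.\<close>

definition dyadic_set :: "nat \<Rightarrow> int \<Rightarrow> (nat \<Rightarrow> int) \<Rightarrow> int set" where
  "dyadic_set k L f = (\<lambda>i. 2 * L * 2 ^ i + f i) ` {..<k}"

lemma digits_unique:
  fixes M u v s t :: int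
  assumes "M * u + s = M * v + t" "0 \<le> s" "s < M" "0 \<le> t" "t < M"
  shows "u = v \<and> s = t"
proof -
  have "u = (M * u + s) div M" "v = (M * v + t) div M" using assms(2-5) by simp_all
  with assms(1) show ?thesis by simp
qed

text \<open>Without carries, the block at \<open>2 ^ i + 2 ^ j\<close> receives only sums from
  indices \<open>p\<close>, \<open>q\<close> with \<open>2 ^ p + 2 ^ q = 2 ^ i + 2 ^ j\<close>, that
  is \<open>{p, q} = {i, j}\<close>.\<close>

lemma dyadic_sumset_slice:
  assumes f: "\<And>i. i < k \<Longrightarrow> f i \<in> {0..<L}" and g: "\<And>i. i < k \<Longrightarrow> g i \<in> {0..<L}"
    and ij: "i < k" "j < k"
  shows "{t. 0 \<le> t \<and> t < 2 * L \<and> 2 * L * (2 ^ i + 2 ^ j) + t \<in> dyadic_set k L f + dyadic_set k L g}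
    = {f i + g j, f j + g i}" (is "?S = _")
proof
  show "?S \<subseteq> {f i + g j, f j + g i}"
  proof
    fix t assume "t \<in> ?S"
    then have t: "0 \<le> t" "t < 2 * L"
      and "2 * L * (2 ^ i + 2 ^ j) + t \<in> dyadic_set k L f + dyadic_set k L g"
      by simp_all
    from this(3) obtain p q where pq: "p < k" "q < k"
      and "2 * L * (2 ^ i + 2 ^ j) + t = (2 * L * 2 ^ p + f p) + (2 * L * 2 ^ q + g q)"
      unfolding dyadic_set_def set_plus_def by auto
    then have "2 * L * (2 ^ p + 2 ^ q) + (f p + g q) = 2 * L * (2 ^ i + 2 ^ j) + t"
      by (simp add: algebra_simps)
    from digits_unique[OF this] have "(2::int) ^ p + 2 ^ q = 2 ^ i + 2 ^ j" "t = f p + g q"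
      using f[OF pq(1)] g[OF pq(2)] t by auto
    with sum_power2_eqD[of p q i j] show "t \<in> {f i + g j, f j + g i}"
      by (auto simp: doubleton_eq_iff)
  qed
  have mem: "2 * L * (2 ^ p + 2 ^ q) + (f p + g q) \<in> dyadic_set k L f + dyadic_set k L g" if "p < k" "q < k" for p q
  proof -
    have "2 * L * (2 ^ p + 2 ^ q) + (f p + g q) = (2 * L * 2 ^ p + f p) + (2 * L * 2 ^ q + g q)"
      by (simp add: algebra_simps)
    also have "\<dots> \<in> dyadic_set k L f + dyadic_set k L g"
      using that unfolding dyadic_set_def by (intro set_plus_intro imageI) simp_all
    finally show ?thesis .
  qed
  show "{f i + g j, f j + g i} \<subseteq> ?S"
    using mem[of i j] mem[of j i] ij f[of i] f[of j] g[of i] g[of j] by (auto simp: add.commute)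
qed

text \<open>Index 0 yields each unordered pair of values. Fixing the values at 0 excludes adding a
  constant to \<open>f\<close> and subtracting it from \<open>g\<close>, which preserves all cross
  sums.\<close>

lemma cross_sums_determine_pair:
  fixes f g f' g' :: "nat \<Rightarrow> int"
  assumes "f 0 = 0" "g 0 = 0" "f' 0 = 0" "g' 0 = 0" "0 < k"
    and ext: "f \<in> extensional {..<k}" "g \<in> extensional {..<k}" "f' \<in> extensional {..<k}" "g' \<in> extensional {..<k}"
    and cross: "\<And>i j. i < k \<Longrightarrow> j < k \<Longrightarrow> {f i + g j, f j + g i} = {f' i + g' j, f' j + g' i}"
  shows "{f, g} = {f', g'}"
proof -
  have pair: "{f j, g j} = {f' j, g' j}" if "j < k" for j
    using cross[of 0 j] that assms(1-5) by (auto simp: doubleton_eq_iff)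
  show ?thesis
  proof (cases "f = f'")
    case True
    then have "g j = g' j" if "j < k" for j
      using pair[OF that] by (auto simp: doubleton_eq_iff)
    then have "g = g'"
      using ext by (intro extensionalityI[of g "{..<k}" g']) simp_all
    with True show ?thesis by simp
  next
    case False
    then obtain i where i: "i < k" "f i \<noteq> f' i"
      using ext by (meson extensionalityI lessThan_iff)
    \<comment> \<open>The values at \<open>i\<close> are swapped and distinct. If those at
      \<open>j\<close> were kept, the cross sums would force \<open>f j = g j\<close>, which is a
      swap as well.\<close>
    have "f' j = g j \<and> g' j = f j" if "j < k" for j
      using pair[OF i(1)] pair[OF that] cross[OF i(1) that] i(2) by (auto simp: doubleton_eq_iff)
    then have "f' = g" "g' = f"
      using ext extensionalityI[of f' "{..<k}" g] extensionalityI[of g' "{..<k}" f] by simp_all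
    then show ?thesis by auto
  qed
qed

lemma power_le_sidon_F:
  assumes "0 < k" "0 < L" "L * (2 ^ k + 1) \<le> N"
  shows "L ^ (k - 1) \<le> sidon_F k N"
proof -
  define I where "I = PiE {..<k} (\<lambda>i. if i = 0 then {0} else {0..<int L})"
  have "card I = (\<Prod>i\<in>{..<k}. if i = 0 then 1 else L)"
    unfolding I_def by (subst card_PiE) (auto intro: prod.cong)
  also have "\<dots> = L ^ (k - 1)"
  proof -
    have "{..<k} = insert 0 {1..<k}" using \<open>0 < k\<close> by auto
    moreover have "(\<Prod>i\<in>{1..<k}. if i = 0 then 1 else L) = (\<Prod>i\<in>{1..<k}. L)"
      by (intro prod.cong) auto
    ultimately show ?thesis by simp
  qed
  finally have card_I: "card I = L ^ (k - 1)" .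
  have I_ext: "f \<in> extensional {..<k}" and I_0: "f 0 = 0"
    and I_bounds: "\<And>i. i < k \<Longrightarrow> f i \<in> {0..<int L}" if "f \<in> I" for f
    using that assms(1,2) unfolding I_def by (auto simp: PiE_iff split: if_splits)
  have "card I \<le> sidon_F k N"
  proof (rule card_le_sidon_F_family[where \<phi> = "dyadic_set k (int L)"])
    fix f assume f: "f \<in> I"
    have "2 * int L * 2 ^ i + f i \<in> {0..<int N}" if "i < k" for i
    proof -
      \<comment> \<open>The elements stay below \<open>L * 2 ^ k + L\<close>, which is the bound on
        \<open>N\<close>.\<close>
      have "(2::int) * 2 ^ i \<le> 2 ^ k"
        using that power_increasing[of "Suc i" k "2::int"] by simp
      then have "int L * (2 * 2 ^ i) \<le> int L * 2 ^ k" by (intro mult_left_mono) simp_all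
      moreover have "int L * 2 ^ k + int L \<le> int N"
      proof -
        have "int (L * (2 ^ k + 1)) \<le> int N" using assms(3) by (simp only: of_nat_le_iff)
        then show ?thesis by (simp add: algebra_simps)
      qed
      moreover have "2 * int L * 2 ^ i = int L * (2 * 2 ^ i)" "0 \<le> int L * (2 * 2 ^ i)" by simp_all
      moreover have "0 \<le> f i" "f i < int L" using I_bounds[OF f that] by simp_all
      ultimately show ?thesis by (simp only: atLeastLessThan_iff) linarith
    qed
    moreover have "inj_on (\<lambda>i. 2 * int L * 2 ^ i + f i) {..<k}"
    proof (rule inj_onI)
      fix i j assume "i \<in> {..<k}" "j \<in> {..<k}"
        and eq: "2 * int L * 2 ^ i + f i = 2 * int L * 2 ^ j + f j"
      then have "(2::int) ^ i = 2 ^ j"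
        using digits_unique[OF eq] I_bounds[OF f, of i] I_bounds[OF f, of j] by auto
      then show "i = j" by simp
    qed
    ultimately show "dyadic_set k (int L) f \<in> nsets {0..<int N} k"
      unfolding dyadic_set_def nsets_def by (auto simp: card_image)
  next
    fix f g f' g'
    assume mem: "f \<in> I" "g \<in> I" "f' \<in> I" "g' \<in> I"
      and eq: "dyadic_set k (int L) f + dyadic_set k (int L) g =
        dyadic_set k (int L) f' + dyadic_set k (int L) g'"
    have "{f i + g j, f j + g i} = {f' i + g' j, f' j + g' i}" if "i < k" "j < k" for i j
      using dyadic_sumset_slice[of k f "int L" g i j] dyadic_sumset_slice[of k f' "int L" g' i j]
        I_bounds mem that unfolding eq by simp
    then show "{f, g} = {f', g'}"
      using mem assms(1) by (intro cross_sums_determine_pair[of _ _ _ _ k] I_0 I_ext) auto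
  qed
  then show ?thesis by (simp add: card_I)
qed

text \<open>Rounding in \<open>L = N div M\<close> costs at most a factor 2, since
  \<open>L + 1 \<le> 2 * L\<close>.\<close>

lemma sidon_F_ge_const_power:
  assumes "0 < k" "2 ^ k + 1 \<le> N"
  shows "(1 / (2 * (2 ^ k + 1))) ^ (k - 1) * real N ^ (k - 1) \<le> real (sidon_F k N)"
proof -
  define M :: nat where "M = 2 ^ k + 1"
  define L where "L = N div M"
  have "0 < L"
    using assms(2) unfolding L_def by (simp add: M_def div_greater_zero_iff)
  have "L * M \<le> N"
    unfolding L_def by simp
  have "N < M * (L + 1)"
    unfolding L_def using dividend_less_times_div[of M N] by (simp add: M_def)
  also have "\<dots> \<le> M * (2 * L)" using \<open>0 < L\<close> by (intro mult_left_mono) auto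
  finally have "real N \<le> real (M * (2 * L))" by linarith
  then have "real N / (2 * real M) \<le> real L"
    by (subst pos_divide_le_eq) (simp_all add: M_def algebra_simps add_pos_pos)
  then have "(real N / (2 * real M)) ^ (k - 1) \<le> real L ^ (k - 1)"
    by (intro power_mono) simp_all
  also have "\<dots> = real (L ^ (k - 1))" by simp
  also have "\<dots> \<le> real (sidon_F k N)"
    using power_le_sidon_F[of k L N] assms(1) \<open>0 < L\<close> \<open>L * M \<le> N\<close> by (simp add: M_def)
  finally show ?thesis by (simp add: M_def power_divide add.commute)
qed

section \<open>Three-element sets\<close>

text \<open>Of the positive elements on the right only \<open>a\<close> and \<open>b\<close> can
  equal \<open>c\<close>, because \<open>c < r\<close> and \<open>c < d\<close>. Both cases end at
  an excluded ratio 2 or 3.\<close>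

lemma triple_sumset_same_top:
  fixes a b c d r :: int
  assumes S: "{0, a, b, c, d, a + c, a + d, b + c, b + d} = {0, a, b, r, d, a + r, a + d, b + r, b + d}"
    and h: "0 < a" "a < b" "0 < c" "c < d" "r < d"
      "b \<noteq> 2 * a" "d \<noteq> 2 * c" "d \<noteq> 2 * r"
      "b \<noteq> 3 * a" "d \<noteq> 3 * c" "d \<noteq> 3 * r"
      "a \<le> c" "c < r"
  shows False
proof -
  have L: "\<And>x. x \<in> {0, a, b, c, d, a + c, a + d, b + c, b + d} \<Longrightarrow> x = 0 \<or> x = a \<or> x = b \<or> x = r \<or> x = d \<or> x = a + r \<or> x = a + d \<or> x = b + r \<or> x = b + d" using S by blast
  have R: "\<And>x. x \<in> {0, a, b, r, d, a + r, a + d, b + r, b + d} \<Longrightarrow> x = 0 \<or> x = a \<or> x = b \<or> x = c \<or> x = d \<or> x = a + c \<or> x = a + d \<or> x = b + c \<or> x = b + d" using S by blast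
  show False
  proof (cases "c = a")
    case True
    \<comment> \<open>The ratio 2 is excluded, so \<open>2 * a\<close> can only be \<open>r\<close>.
      Then \<open>a + r = 3 * a\<close> has no place on the left.\<close>
    then have "a + c = r" using h L[of "a + c"] by (smt insertCI)
    then show False using h True R[of "a + r"] by (smt insertCI)
  next
    case False
    then have c: "c = b" using h L[of "c"] by (smt insertCI)
    have "a + c = r" using h c L[of "a + c"] R[of r] by (smt insertCI)
    moreover from this have "b + c = a + d" using h c L[of "b + c"] by (smt insertCI)
    \<comment> \<open>Now \<open>r = a + b\<close> and \<open>d = 2 * b - a\<close>. On the left
      \<open>2 * a + b\<close> could only be \<open>d\<close> or \<open>2 * b\<close>, so
      \<open>b\<close> would be \<open>3 * a\<close> or \<open>2 * a\<close>.\<close>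
    ultimately show False using h c R[of "a + r"] by (smt insertCI)
  qed
qed

text \<open>Here \<open>s < d\<close>, and only the exchange of the two sets survives. The cases ask
  which of \<open>c\<close> and \<open>r\<close> equal the common least element
  \<open>a\<close>.\<close>

lemma triple_sumset_lower_top:
  fixes a b c d q r s :: int
  assumes S: "{0, a, b, c, d, a + c, a + d, b + c, b + d} = {0, a, q, r, s, a + r, a + s, q + r, q + s}"
    and h: "0 < a" "a < b" "0 < c" "c < d" "a < q" "0 < r" "r < s"
      "b \<noteq> 2 * a" "d \<noteq> 2 * c" "q \<noteq> 2 * a" "s \<noteq> 2 * r"
      "b \<noteq> 3 * a" "d \<noteq> 3 * c" "q \<noteq> 3 * a" "s \<noteq> 3 * r"
      "a \<le> c" "a \<le> r" "b < q" "b + d = q + s"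
  shows "a = r \<and> b = s \<and> c = a \<and> d = q"
proof -
  have L: "\<And>x. x \<in> {0, a, b, c, d, a + c, a + d, b + c, b + d} \<Longrightarrow> x = 0 \<or> x = a \<or> x = q \<or> x = r \<or> x = s \<or> x = a + r \<or> x = a + s \<or> x = q + r \<or> x = q + s" using S by blast
  have R: "\<And>x. x \<in> {0, a, q, r, s, a + r, a + s, q + r, q + s} \<Longrightarrow> x = 0 \<or> x = a \<or> x = b \<or> x = c \<or> x = d \<or> x = a + c \<or> x = a + d \<or> x = b + c \<or> x = b + d" using S by blast
  consider "c = a" "r = a" | "c = a" "a < r" | "a < c" "r = a" | "a < c" "a < r" using h by (smt (verit))
  then show ?thesis
  proof cases
    case 1
    \<comment> \<open>Besides \<open>2 * a\<close>, only \<open>s\<close> and \<open>a + s\<close>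
      can lie strictly between \<open>a\<close> and \<open>q\<close> on the right.\<close>
    then have "b = s \<or> b = a + s" using h L[of b] by (smt insertCI)
    then show ?thesis using h 1 R[of s] by (smt insertCI)
  next
    case 2
    then have "a + c = r \<or> a + c = s" using h L[of "a + c"] by (smt insertCI)
    then show ?thesis using h R[of "a + r"] R[of q] 2 by (smt insertCI)
  next
    case 3
    then have "b = s \<or> b = a + s" using h L[of b] by (smt insertCI)
    then show ?thesis
    proof
      assume b: "b = s"
      then have "a + d = q + r" using h 3 L[of "a + d"] by (smt insertCI)
      moreover have "a + r = c" using h b 3 R[of "a + r"] by (smt insertCI)
      \<comment> \<open>With \<open>c = 2 * a\<close>, the left element \<open>a + c = 3 * a\<close>
        has no place on the right.\<close>
      ultimately show ?thesis using h 3 b L[of "a + c"] by (smt insertCI)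
    next
      assume b: "b = a + s"
      have d: "d = a + s" using h 3 b L[of "d"] by (smt insertCI)
      have "a + d = q" using h b d 3 L[of "a + d"] by (smt insertCI)
      moreover from this have "b + c = q + r" using h b d 3 L[of "b + c"] by (smt insertCI)
      ultimately show ?thesis using h 3 b d L[of "a + c"] by (smt insertCI)
    qed
  next
    case 4
    \<comment> \<open>All of \<open>r\<close>, \<open>s\<close>, \<open>a + r\<close>,
      \<open>a + s\<close> are below \<open>a + d\<close> by \<open>s < d\<close>, and
      \<open>q + s = b + d\<close> is above it.\<close>
    then have "a + d = q \<or> a + d = q + r" using h L[of "a + d"] by (smt insertCI)
    then show ?thesis
    proof
      assume d: "a + d = q"
      then have "q + r = b + c" using h 4 R[of "q + r"] by (smt insertCI)
      then show ?thesis using h 4 d R[of r] by (smt insertCI)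
    next
      assume d: "a + d = q + r"
      then have "b = r" using h 4 L[of b] by (smt insertCI)
      moreover from this have "d = a + s" using h 4 d L[of d] by (smt insertCI)
      moreover from calculation have "q = c" using h 4 d R[of q] by (smt insertCI)
      ultimately show ?thesis using h 4 d L[of "a + c"] by (smt insertCI)
    qed
  qed
qed

text \<open>
  Both lines have to be excluded: \<open>{0, 1, 2} + {0, 1, 3} = {0, 1, 2} + {0, 2, 3}\<close> and
  \<open>{0, 1, 3} + {0, 4, 6} = {0, 1, 4} + {0, 3, 5}\<close>.
\<close>

definition admissible :: "int \<Rightarrow> int \<Rightarrow> bool" where
  "admissible a b \<longleftrightarrow> 0 < a \<and> a < b \<and> b \<noteq> 2 * a \<and> b \<noteq> 3 * a"

text \<open>The extreme elements give \<open>a = p\<close> and \<open>b + d = q + s\<close>. If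
  \<open>b\<close> and \<open>q\<close> differ, the two sides are exchanged; if they agree, so do
  the second sets.\<close>

lemma triple_sumset_eqD_ordered:
  assumes adm: "admissible a b" "admissible c d" "admissible p q" "admissible r s"
    and ord: "a \<le> c" "p \<le> r"
    and eq: "{0, a, b} + {0, c, d} = {0, p, q} + {0, r, s}"
  shows "a = p \<and> b = q \<and> c = r \<and> d = s \<or> a = r \<and> b = s \<and> c = p \<and> d = q"
proof -
  have expand: "{0, x, y} + {0, u, v} = {0, x, y, u, v, x + u, x + v, y + u, y + v}" for x y u v :: int
    by (auto simp: set_plus_def)
  have S: "{0, a, b, c, d, a + c, a + d, b + c, b + d} = {0, p, q, r, s, p + r, p + s, q + r, q + s}"
    using eq unfolding expand .
  have pos: "0 < a" "a < b" "0 < c" "c < d" "0 < p" "p < q" "0 < r" "r < s"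
    using adm by (simp_all add: admissible_def)
  have ap: "a = p"
  proof (rule antisym)
    have "p \<in> {0, a, b, c, d, a + c, a + d, b + c, b + d}" using S by blast
    then show "a \<le> p" using pos(1-5) ord(1) by auto
    have "a \<in> {0, p, q, r, s, p + r, p + s, q + r, q + s}" using S by blast
    then show "p \<le> a" using pos(5-8,1) ord(2) by auto
  qed
  have top: "b + d = q + s"
  proof (rule antisym)
    have "b + d \<in> {0, p, q, r, s, p + r, p + s, q + r, q + s}" using S by blast
    then show "b + d \<le> q + s" using pos(5-8) by auto
    have "q + s \<in> {0, a, b, c, d, a + c, a + d, b + c, b + d}" using S by blast
    then show "q + s \<le> b + d" using pos(1-4) by auto
  qed
  note S = S[folded ap]
  note h = pos[folded ap] ord[folded ap] top top[symmetric] adm[unfolded admissible_def, folded ap]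
  consider "b < q" | "q < b" | "b = q" by linarith
  then show ?thesis
  proof cases
    case 1
    have "a = r \<and> b = s \<and> c = a \<and> d = q"
      by (rule triple_sumset_lower_top[OF S]) (use h 1 in blast)+
    with ap show ?thesis by simp
  next
    case 2
    have "a = c \<and> q = d \<and> r = a \<and> s = b"
      by (rule triple_sumset_lower_top[OF S[symmetric]]) (use h 2 in blast)+
    with ap show ?thesis by simp
  next
    case 3
    then have "q = b" "s = d" using top by simp_all
    note S' = S[unfolded this] and h' = h[unfolded this]
    have "\<not> c < r"
    proof
      assume "c < r"
      show False
        by (rule triple_sumset_same_top[OF S']) (use h' \<open>c < r\<close> in blast)+
    qed
    moreover have "\<not> r < c"
    proof
      assume "r < c"
      show False
        by (rule triple_sumset_same_top[OF S'[symmetric]]) (use h' \<open>r < c\<close> in blast)+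
    qed
    ultimately show ?thesis using ap \<open>q = b\<close> \<open>s = d\<close> by simp
  qed
qed

lemma triple_sumset_eqD:
  assumes adm: "admissible a b" "admissible c d" "admissible p q" "admissible r s"
    and eq: "{0, a, b} + {0, c, d} = {0, p, q} + {0, r, s}"
  shows "a = p \<and> b = q \<and> c = r \<and> d = s \<or> a = r \<and> b = s \<and> c = p \<and> d = q"
proof -
  have eqs: "{0, c, d} + {0, a, b} = {0, p, q} + {0, r, s}" "{0, a, b} + {0, c, d} = {0, r, s} + {0, p, q}"
    "{0, c, d} + {0, a, b} = {0, r, s} + {0, p, q}"
    using eq by (simp_all only: add.commute)
  consider "a \<le> c" "p \<le> r" | "c \<le> a" "p \<le> r" | "a \<le> c" "r \<le> p" | "c \<le> a" "r \<le> p" by linarith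
  then show ?thesis
  proof cases
    case 1
    from triple_sumset_eqD_ordered[OF adm 1 eq] show ?thesis .
  next
    case 2
    from triple_sumset_eqD_ordered[OF adm(2,1,3,4) 2 eqs(1)] show ?thesis by blast
  next
    case 3
    from triple_sumset_eqD_ordered[OF adm(1,2,4,3) 3 eqs(2)] show ?thesis by blast
  next
    case 4
    from triple_sumset_eqD_ordered[OF adm(2,1,4,3) 4 eqs(3)] show ?thesis by blast
  qed
qed

lemma card_admissible_le_sidon_F:
  "card {(a, b). admissible a b \<and> b < int N} \<le> sidon_F 3 N"
proof (rule card_le_sidon_F_family[where \<phi> = "\<lambda>(a, b). {0, a, b}"])
  show "(case i of (a, b) \<Rightarrow> {0, a, b}) \<in> nsets {0..<int N} 3"
    if "i \<in> {(a, b). admissible a b \<and> b < int N}" for i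
    using that by (auto simp: admissible_def nsets_def)
next
  let ?I = "{(a, b). admissible a b \<and> b < int N}" and ?\<phi> = "\<lambda>(a, b). {0, a, b}"
  fix i j i' j' assume mem: "i \<in> ?I" "j \<in> ?I" "i' \<in> ?I" "j' \<in> ?I" and eq: "?\<phi> i + ?\<phi> j = ?\<phi> i' + ?\<phi> j'"
  obtain a b c d p q r s where "i = (a, b)" "j = (c, d)" "i' = (p, q)" "j' = (r, s)"
    by (metis surj_pair)
  then show "{i, j} = {i', j'}"
    using mem eq triple_sumset_eqD[of a b c d p q r s] by auto
qed

text \<open>Passing from \<open>N\<close> to \<open>Suc N\<close> adds the \<open>N - 1\<close>
  pairs \<open>(a, N)\<close>; the truncated difference at \<open>N = 0\<close> is the reason for
  the final case split.\<close>

lemma card_ordered_pairs: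
  "(real N)\<^sup>2 - 3 * real N \<le> 2 * real (card {(a, b). 0 < a \<and> a < b \<and> b < int N})"
proof (induction N)
  case 0
  then show ?case by simp
next
  case (Suc N)
  let ?P = "\<lambda>N. {(a, b). 0 < a \<and> a < b \<and> b < int N}"
  have fin: "finite (?P N)"
    by (rule finite_subset[of _ "{0..int N} \<times> {0..int N}"]) auto
  have "?P (Suc N) = ?P N \<union> (\<lambda>a. (a, int N)) ` {1..<int N}" by auto
  then have "card (?P (Suc N)) = card (?P N) + card ((\<lambda>a. (a, int N)) ` {1..<int N})"
    using fin by (simp only:) (rule card_Un_disjoint, auto)
  also have "card ((\<lambda>a. (a, int N)) ` {1..<int N}) = N - 1"
    by (subst card_image) (auto simp: inj_on_def)
  finally show ?case using Suc by (cases N) (auto simp: power2_eq_square algebra_simps)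
qed

text \<open>Each excluded line costs at most \<open>N\<close> pairs and the count of ordered pairs
  loses \<open>3 * N / 2\<close>, in total less than \<open>4 * N\<close> for positive
  \<open>N\<close>.\<close>

lemma sidon_F_3_ge: "(real N)\<^sup>2 / 2 - 4 * real N \<le> real (sidon_F 3 N)"
proof -
  let ?I = "{(a, b). admissible a b \<and> b < int N}"
  let ?J = "\<lambda>m. (\<lambda>a. (a, m * a)) ` {1..int N}"
  have fin: "finite ?I"
    by (rule finite_subset[of _ "{0..int N} \<times> {0..int N}"]) (auto simp: admissible_def)
  have "{(a, b). 0 < a \<and> a < b \<and> b < int N} \<subseteq> ?I \<union> (?J 2 \<union> ?J 3)"
    by (auto simp: admissible_def)
  then have "card {(a, b). 0 < a \<and> a < b \<and> b < int N} \<le> card (?I \<union> (?J 2 \<union> ?J 3))"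
    using fin by (intro card_mono) auto
  also have "\<dots> \<le> card ?I + (card (?J 2) + card (?J 3))"
    by (meson card_Un_le add_left_mono order_trans)
  also have "\<dots> \<le> card ?I + (N + N)"
    using card_image_le[of "{1..int N}" "\<lambda>a. (a, 2 * a)"] card_image_le[of "{1..int N}" "\<lambda>a. (a, 3 * a)"]
    by simp
  also have "\<dots> \<le> sidon_F 3 N + (N + N)"
    using card_admissible_le_sidon_F by simp
  finally show ?thesis using card_ordered_pairs[of N] by linarith
qed

theorem theorem1p4:
  shows "(\<forall>N::nat. N > 2 \<longrightarrow> int (sidon_F 2 N) = 2 * int N - 3) \<and>
    (\<exists>C::real. \<forall>N::nat. N > 3 \<longrightarrow> real (sidon_F 3 N) \<ge> (real N)\<^sup>2 / 2 - C * real N) \<and>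
    (\<forall>k::nat. k \<ge> 4 \<longrightarrow>
      (\<exists>c::real. c > 0 \<and>
        (\<exists>N0::nat. \<forall>N::nat. N \<ge> N0 \<longrightarrow> real (sidon_F k N) \<ge> c * real N ^ (k - 1))))"
proof (intro conjI allI impI)
  show "int (sidon_F 2 N) = 2 * int N - 3" if "N > 2" for N
    using sidon_F_2_le[OF that] sidon_F_2_ge[OF that] by simp
  show "\<exists>C::real. \<forall>N::nat. N > 3 \<longrightarrow> real (sidon_F 3 N) \<ge> (real N)\<^sup>2 / 2 - C * real N"
    using sidon_F_3_ge by blast
  fix k :: nat
  assume "k \<ge> 4"
  then have "\<forall>N \<ge> 2 ^ k + 1. (1 / (2 * (2 ^ k + 1))) ^ (k - 1) * real N ^ (k - 1) \<le> real (sidon_F k N)"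
    using sidon_F_ge_const_power by simp
  moreover have "0 < (1 / (2 * (2 ^ k + 1))::real) ^ (k - 1)"
    by (simp add: add_pos_pos)
  ultimately show "\<exists>c::real. c > 0 \<and>
      (\<exists>N0::nat. \<forall>N::nat. N \<ge> N0 \<longrightarrow> real (sidon_F k N) \<ge> c * real N ^ (k - 1))"
    by blast
qed

end
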